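(* $HJ(3;3)\ge 14$.
   Context: For $k\in\mathbb{Z}^+$ let $[k]=\{1,2,\dots,k\}$. A variable word over $[k]$ of length $n$ is a vector $w(x)\in([k]\cup\{x\})^n$ containing at least one occurrence of the symbol $x$; for $a\in[k]$, $w(a)\in[k]^n$ is obtained by replacing every occurrence of $x$ by $a$. The combinatorial line determined by $w(x)$ is $L(w)=\{w(a):a\in[k]\}\subseteq[k]^n$. The Hales-Jewett number $HJ(k;r)$ is the least positive integer $N$ such that for all $n\ge N$ every $r$-coloring of the points of $[k]^n$ admits a monochromatic combinatorial line (it exists by the Hales-Jewett theorem). *)

theory Defs
  imports Main "HOL-Library.FuncSet"
begin

definition cube :: "nat \<Rightarrow> nat \<Rightarrow> nat list set" where
  "cube k n = {p. length p = n \<and> set p \<subseteq> {1..k}}"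

text \<open>The symbol \<open>x\<close> of a variable word is represented by \<open>None\<close>, a letter \<open>a\<close> by \<open>Some a\<close>.\<close>

definition variable_words :: "nat \<Rightarrow> nat \<Rightarrow> nat option list set" where
  "variable_words k n =
     {w. length w = n \<and> set w \<subseteq> insert None (Some ` {1..k}) \<and> None \<in> set w}"

definition word_at :: "nat option list \<Rightarrow> nat \<Rightarrow> nat list" where
  "word_at w a = map (\<lambda>s. case s of None \<Rightarrow> a | Some b \<Rightarrow> b) w"

definition line :: "nat \<Rightarrow> nat option list \<Rightarrow> nat list set" where
  "line k w = word_at w ` {1..k}"

definition monochromatic :: "('a \<Rightarrow> 'b) \<Rightarrow> 'a set \<Rightarrow> bool" where
  "monochromatic c A \<longleftrightarrow> (\<exists>i. \<forall>p\<in>A. c p = i)"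

text \<open>The least element exists whenever \<open>k\<close> and \<open>r\<close> are positive, by the Hales--Jewett theorem;
  for other arguments the value is irrelevant.\<close>

definition HJ :: "nat \<Rightarrow> nat \<Rightarrow> nat" where
  "HJ k r = (LEAST N. N > 0 \<and>
     (\<forall>n\<ge>N. \<forall>c \<in> cube k n \<rightarrow> {1..r}.
        \<exists>w \<in> variable_words k n. monochromatic c (line k w)))"

end

theory Submission
  imports Defs "HOL-Library.Countable" "HOL-Number_Theory.Cong"
begin

text \<open>
  The bound has two ingredients of quite different kinds.

  A number defined as the least element of a set is bounded below only if the set is nonempty, so
  the Hales--Jewett theorem itself is needed. The proof is Shelah's, by induction on the
  alphabet: for a given colouring of a cube over \<open>k + 1\<close> letters one finds a subspace of
  prescribed dimension on which the letters \<open>k\<close> and \<open>k + 1\<close> can be exchanged in any coordinate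
  without a change of colour (\<open>insensitive_subspace\<close>). A monochromatic line over the first \<open>k\<close>
  letters of that subspace then stays monochromatic when its last point is added.

  It remains to colour \<open>[3]\<^sup>1\<^sup>3\<close> with three colours and no monochromatic line. Give the letters
  1, 2, 3 the weights 0, 1, 4 and let the weight of a point be the sum over its coordinates. The
  three points of a line with \<open>r\<close> active coordinates have weights \<open>s\<close>, \<open>s + r\<close>, \<open>s + 4 r\<close>.
  Colour a point whose weight is nonzero modulo 13 by the coset of the cubes in the multiplicative
  group modulo 13 to which the weight belongs; there are three cosets. For \<open>r\<close> prime to 13,
  division by \<open>r\<close> permutes the cosets and turns the weights into \<open>u\<close>, \<open>u + 1\<close>, \<open>u + 4\<close>, and for
  each of the 13 residues \<open>u\<close> two of these numbers are nonzero and lie in different cosets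
  (\<open>cubic_class_separates\<close>). The line is therefore not monochromatic, however the points
  of weight zero are coloured. In dimension 13 a single line is left, the diagonal, where
  \<open>r = 13\<close>. All its points have weight zero, and the freedom in colouring such points is used to
  give two of them different colours.
\<close>

section \<open>The Hales--Jewett theorem\<close>

lemma finite_cube: "finite (cube k n)"
  unfolding cube_def using finite_lists_length_eq[of "{1..k}" n]
  by (rule rev_finite_subset) auto

lemma append_in_cube: "x \<in> cube k m \<Longrightarrow> y \<in> cube k n \<Longrightarrow> x @ y \<in> cube k (m + n)"
  by (auto simp: cube_def)

lemma word_at_in_cube:
  "w \<in> variable_words k n \<Longrightarrow> a \<in> {1..k} \<Longrightarrow> word_at w a \<in> cube k n"
  unfolding variable_words_def cube_def word_at_def
  by (auto split: option.splits)

text \<open>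
  Among the \<open>card D + 1\<close> words \<open>k \<dots> k (k+1) \<dots> (k+1)\<close> of length \<open>card D\<close> two have the same
  colour. They differ on an interval of coordinates, which is constantly \<open>k\<close> in one of them and
  constantly \<open>k + 1\<close> in the other, so making this interval variable gives the required word.
  The colours have an arbitrary type because they will be colourings of another cube.
\<close>

lemma insensitive_block:
  fixes D :: "'b set"
  assumes "finite D" "k \<ge> 1"
  shows "\<exists>M. \<forall>d \<in> cube (Suc k) M \<rightarrow> D.
    \<exists>w \<in> variable_words (Suc k) M. d (word_at w k) = d (word_at w (Suc k))"
proof (intro exI ballI)
  let ?M = "card D"
  fix d assume d: "d \<in> cube (Suc k) ?M \<rightarrow> D"
  let ?x = "\<lambda>j. replicate j k @ replicate (?M - j) (Suc k)"
  have "(\<lambda>j. d (?x j)) ` {..?M} \<subseteq> D"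
  proof safe
    fix j assume "j \<le> ?M"
    then have "?x j \<in> cube (Suc k) ?M" using assms(2) by (auto simp: cube_def)
    with d show "d (?x j) \<in> D" by blast
  qed
  then have "card ((\<lambda>j. d (?x j)) ` {..?M}) < card {..?M}"
    using card_mono[OF assms(1)] by (simp add: le_imp_less_Suc)
  then have "\<not> inj_on (\<lambda>j. d (?x j)) {..?M}" by (rule pigeonhole)
  then obtain i' j' where "i' \<le> ?M" "j' \<le> ?M" "i' \<noteq> j'" "d (?x i') = d (?x j')"
    by (auto simp: inj_on_def)
  then obtain i j where ij: "i < j" "j \<le> ?M" "d (?x j) = d (?x i)"
    by (metis linorder_neqE_nat)
  let ?w = "replicate i (Some k) @ replicate (j - i) None @ replicate (?M - j) (Some (Suc k))"
  have "?w \<in> variable_words (Suc k) ?M"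
    using ij assms(2) by (auto simp: variable_words_def)
  moreover have "word_at ?w k = ?x j"
  proof -
    have "replicate j k = replicate i k @ replicate (j - i) k"
      using ij(1) replicate_add[of i "j - i" k] by simp
    then show ?thesis by (simp add: word_at_def)
  qed
  moreover have "word_at ?w (Suc k) = ?x i"
  proof -
    have "replicate (?M - i) (Suc k) = replicate (j - i) (Suc k) @ replicate (?M - j) (Suc k)"
      using ij(1,2) replicate_add[of "j - i" "?M - j" "Suc k"] by simp
    then show ?thesis by (simp add: word_at_def)
  qed
  ultimately show "\<exists>w \<in> variable_words (Suc k) ?M. d (word_at w k) = d (word_at w (Suc k))"
    using ij(3) by (intro bexI[of _ ?w]) simp_all
qed

text \<open>
  A list of \<open>n\<close> variable words, each with its own variable, parametrises an \<open>n\<close>-dimensional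
  subspace of the cube whose dimension is the total length; \<open>substitute\<close> is the parametrisation.
\<close>

definition substitute :: "nat option list list \<Rightarrow> nat list \<Rightarrow> nat list" where
  "substitute ws y = concat (map2 word_at ws y)"

text \<open>
  The same parametrisation applied to a variable word: it carries the lines of the small cube to
  lines of the large one, as \<open>word_at_substitute_word\<close> shows.
\<close>

definition substitute_word ::
    "nat option list list \<Rightarrow> nat option list \<Rightarrow> nat option list" where
  "substitute_word ws v =
     concat (map2 (\<lambda>w s. case s of None \<Rightarrow> w | Some b \<Rightarrow> map Some (word_at w b)) ws v)"

lemma substitute_Cons: "substitute (w # ws) (a # y) = word_at w a @ substitute ws y"
  by (simp add: substitute_def)

lemma length_substitute:
  "length ws = length y \<Longrightarrow> length (substitute ws y) = length (concat ws)"
  by (induction ws y rule: list_induct2) (auto simp: substitute_def word_at_def)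

lemma substitute_in_cube:
  assumes "length ws = length y" "\<forall>w\<in>set ws. w \<in> variable_words k (length w)" "set y \<subseteq> {1..k}"
  shows "substitute ws y \<in> cube k (length (concat ws))"
  using assms
proof (induction ws y rule: list_induct2)
  case Nil
  then show ?case by (simp add: substitute_def cube_def)
next
  case (Cons w ws a y)
  then have "word_at w a \<in> cube k (length w)" "substitute ws y \<in> cube k (length (concat ws))"
    by (auto intro: word_at_in_cube)
  from append_in_cube[OF this] show ?case by (simp add: substitute_Cons)
qed

lemma word_at_substitute_word:
  assumes "length ws = length v"
  shows "word_at (substitute_word ws v) a = substitute ws (word_at v a)"
  using assms
proof (induction ws v rule: list_induct2)
  case Nil
  then show ?case by (simp add: substitute_def substitute_word_def word_at_def)
next
  case (Cons w ws s v)
  then show ?case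
    by (cases s) (simp_all add: substitute_def substitute_word_def word_at_def comp_def)
qed

lemma substitute_word_variable:
  assumes "length ws = length v" "\<forall>w\<in>set ws. w \<in> variable_words k (length w)"
    and "v \<in> variable_words k n"
  shows "substitute_word ws v \<in> variable_words k (length (concat ws))"
proof -
  have "length (substitute_word ws v) = length (concat ws) \<and>
        set (substitute_word ws v) \<subseteq> insert None (Some ` {1..k}) \<and>
        (None \<in> set v \<longrightarrow> None \<in> set (substitute_word ws v))"
    if "set v \<subseteq> insert None (Some ` {1..k})"
    using assms(1,2) that
  proof (induction ws v rule: list_induct2)
    case Nil
    then show ?case by (simp add: substitute_word_def)
  next
    case (Cons w ws s v)
    have w: "w \<in> variable_words k (length w)" using Cons.prems by simp
    show ?case
    proof (cases s)
      case None
      with Cons w show ?thesis by (auto simp: substitute_word_def variable_words_def)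
    next
      case (Some b)
      then have "word_at w b \<in> cube k (length w)"
        using Cons.prems w by (auto intro: word_at_in_cube)
      with Cons Some show ?thesis by (auto simp: substitute_word_def cube_def)
    qed
  qed
  with assms(3) show ?thesis by (auto simp: variable_words_def)
qed

definition collapse :: "nat \<Rightarrow> nat \<Rightarrow> nat" where
  "collapse k a = (if a = Suc k then k else a)"

text \<open>
  Shelah's lemma, by induction on the dimension \<open>n\<close> of the subspace. Once the length \<open>N\<close> of the
  last \<open>n\<close> blocks is known, the first block is found by colouring its words \<open>x\<close> with the functions
  \<open>y \<mapsto> c (x @ y)\<close> on the cube of dimension \<open>N\<close>. The number \<open>N\<close> must not depend on that first
  block, so the remaining blocks are chosen for a colouring of \<open>y\<close> that records the colours of
  \<open>word_at w a @ y\<close> for all letters \<open>a\<close> at once. Such a record is a list of colours; keeping the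
  colours in \<open>nat\<close> allows it to be encoded as a colour again, so that the induction
  hypothesis applies to it.
\<close>

lemma insensitive_subspace:
  fixes C :: "nat set"
  assumes "finite C" "k \<ge> 1"
  shows "\<exists>N. \<forall>c \<in> cube (Suc k) N \<rightarrow> C. \<exists>ws. length ws = n \<and> length (concat ws) = N \<and>
    (\<forall>w\<in>set ws. w \<in> variable_words (Suc k) (length w)) \<and>
    (\<forall>y\<in>cube (Suc k) n. c (substitute ws y) = c (substitute ws (map (collapse k) y)))"
  using assms(1)
proof (induction n arbitrary: C)
  case 0
  show ?case by (intro exI[of _ 0] ballI exI[of _ "[]"]) (simp add: substitute_def)
next
  case (Suc n)
  let ?K = "Suc k"
  let ?C' = "to_nat ` {xs :: nat list. set xs \<subseteq> C \<and> length xs = ?K}"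
  have "finite ?C'" using finite_lists_length_eq[OF Suc.prems] by simp
  from Suc.IH[OF this] obtain N where N: "\<forall>c \<in> cube ?K N \<rightarrow> ?C'. \<exists>ws. length ws = n \<and>
      length (concat ws) = N \<and> (\<forall>w\<in>set ws. w \<in> variable_words ?K (length w)) \<and>
      (\<forall>y\<in>cube ?K n. c (substitute ws y) = c (substitute ws (map (collapse k) y)))"
    by blast
  have "finite (cube ?K N \<rightarrow>\<^sub>E C)" by (intro finite_PiE finite_cube Suc.prems)
  from insensitive_block[OF this assms(2)] obtain M where
    M: "\<forall>d \<in> cube ?K M \<rightarrow> (cube ?K N \<rightarrow>\<^sub>E C).
      \<exists>w \<in> variable_words ?K M. d (word_at w k) = d (word_at w ?K)"
    by blast
  show ?case
  proof (intro exI[of _ "M + N"] ballI)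
    fix c assume c: "c \<in> cube ?K (M + N) \<rightarrow> C"
    let ?d = "\<lambda>x. restrict (\<lambda>y. c (x @ y)) (cube ?K N)"
    have "?d \<in> cube ?K M \<rightarrow> (cube ?K N \<rightarrow>\<^sub>E C)"
      using c append_in_cube by fastforce
    from bspec[OF M this] obtain w
      where w: "w \<in> variable_words ?K M" "?d (word_at w k) = ?d (word_at w ?K)"
      by (elim bexE)
    have first: "c (word_at w (collapse k a) @ y) = c (word_at w a @ y)"
      if "y \<in> cube ?K N" for a y
      using fun_cong[OF w(2), of y] that by (simp add: collapse_def)
    let ?c' = "\<lambda>y. to_nat (map (\<lambda>a. c (word_at w a @ y)) [1..<Suc ?K])"
    have "?c' \<in> cube ?K N \<rightarrow> ?C'"
    proof
      fix y assume y: "y \<in> cube ?K N"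
      have "c (word_at w a @ y) \<in> C" if "a \<in> {1..?K}" for a
        using append_in_cube[OF word_at_in_cube[OF w(1) that] y] c by blast
      then show "?c' y \<in> ?C'" by (intro imageI) (auto simp del: upt_Suc)
    qed
    from bspec[OF N this] obtain ws where ws: "length ws = n" "length (concat ws) = N"
      "\<forall>w\<in>set ws. w \<in> variable_words ?K (length w)"
      "\<And>y. y \<in> cube ?K n \<Longrightarrow> ?c' (substitute ws y) = ?c' (substitute ws (map (collapse k) y))"
      by blast
    have rest: "c (word_at w a @ substitute ws y) =
        c (word_at w a @ substitute ws (map (collapse k) y))"
      if "y \<in> cube ?K n" "a \<in> {1..?K}" for a y
    proof -
      have "a \<in> set [1..<Suc ?K]" using that(2) by auto
      with ws(4)[OF that(1)] show ?thesis
        unfolding inj_eq[OF inj_to_nat] map_eq_conv by blast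
    qed
    have len: "length w = M" using w(1) by (simp add: variable_words_def)
    show "\<exists>ws. length ws = Suc n \<and> length (concat ws) = M + N \<and>
        (\<forall>w\<in>set ws. w \<in> variable_words ?K (length w)) \<and>
        (\<forall>y\<in>cube ?K (Suc n). c (substitute ws y) = c (substitute ws (map (collapse k) y)))"
    proof (intro exI[of _ "w # ws"] conjI ballI)
      fix z assume "z \<in> cube ?K (Suc n)"
      then obtain a y where z: "z = a # y" "a \<in> {1..?K}" "y \<in> cube ?K n"
        by (cases z) (auto simp: cube_def)
      have "substitute ws (map (collapse k) y) \<in> cube ?K N"
        using substitute_in_cube[of ws "map (collapse k) y" ?K] ws z(3) assms(2)
        by (fastforce simp: cube_def collapse_def)
      with rest[OF z(3,2)] first show
        "c (substitute (w # ws) z) = c (substitute (w # ws) (map (collapse k) z))"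
        by (simp add: z(1) substitute_Cons)
    qed (use ws w len in auto)
  qed
qed

text \<open>
  Inside a subspace that is insensitive to exchanging \<open>k\<close> and \<open>k + 1\<close>, whose dimension is large
  enough for the alphabet \<open>[k]\<close>, the induction hypothesis gives a line \<open>v\<close> that is monochromatic for
  the letters up to \<open>k\<close>. Collapsing \<open>k + 1\<close> to \<open>k\<close> takes its point \<open>v(k+1)\<close> to \<open>v(k)\<close>, so
  that point has the same colour.
\<close>

lemma Hales_Jewett_dimension:
  fixes C :: "nat set"
  assumes "finite C" "k \<ge> 1"
  shows "\<exists>N. \<forall>c \<in> cube k N \<rightarrow> C. \<exists>w \<in> variable_words k N. monochromatic c (line k w)"
  using assms(2)
proof (induction k rule: dec_induct)
  case base
  show ?case
  proof (intro exI[of _ 1] ballI bexI[of _ "[None]"])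
    show "monochromatic c (line 1 [None])" for c :: "nat list \<Rightarrow> nat"
      by (simp add: monochromatic_def line_def)
  qed (simp add: variable_words_def)
next
  case (step k)
  from step.IH obtain n where
    n: "\<forall>c \<in> cube k n \<rightarrow> C. \<exists>w \<in> variable_words k n. monochromatic c (line k w)" by blast
  from insensitive_subspace[OF assms(1) step.hyps(1), of n] obtain N where
    N: "\<forall>c \<in> cube (Suc k) N \<rightarrow> C. \<exists>ws. length ws = n \<and> length (concat ws) = N \<and>
    (\<forall>w\<in>set ws. w \<in> variable_words (Suc k) (length w)) \<and>
    (\<forall>y\<in>cube (Suc k) n. c (substitute ws y) = c (substitute ws (map (collapse k) y)))"
    by blast
  show ?case
  proof (intro exI[of _ N] ballI)
    fix c assume c: "c \<in> cube (Suc k) N \<rightarrow> C"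
    with N obtain ws where ws: "length ws = n" "length (concat ws) = N"
      "\<forall>w\<in>set ws. w \<in> variable_words (Suc k) (length w)"
      "\<And>y. y \<in> cube (Suc k) n \<Longrightarrow> c (substitute ws y) = c (substitute ws (map (collapse k) y))"
      by blast
    have "(\<lambda>y. c (substitute ws y)) \<in> cube k n \<rightarrow> C"
    proof
      fix y assume "y \<in> cube k n"
      then have "substitute ws y \<in> cube (Suc k) N"
        using substitute_in_cube[of ws y "Suc k"] ws by (fastforce simp: cube_def)
      with c show "c (substitute ws y) \<in> C" by blast
    qed
    with n obtain v where v: "v \<in> variable_words k n"
      and "monochromatic (\<lambda>y. c (substitute ws y)) (line k v)" by blast
    then obtain i where i: "\<And>a. a \<in> {1..k} \<Longrightarrow> c (substitute ws (word_at v a)) = i"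
      by (auto simp: monochromatic_def line_def)
    have v': "v \<in> variable_words (Suc k) n" and len: "length ws = length v"
      using v ws(1) by (auto simp: variable_words_def)
    have "map (collapse k) (word_at v (Suc k)) = word_at v k"
      using v by (auto simp: variable_words_def word_at_def collapse_def split: option.splits)
    with ws(4)[OF word_at_in_cube[OF v']] i[of k] step.hyps(1)
    have top: "c (substitute ws (word_at v (Suc k))) = i" by simp
    have "c (substitute ws (word_at v a)) = i" if "a \<in> {1..Suc k}" for a
      using top i[of a] that by (cases "a = Suc k") auto
    then have "monochromatic c (line (Suc k) (substitute_word ws v))"
      by (auto simp: monochromatic_def line_def word_at_substitute_word[OF len])
    moreover have "substitute_word ws v \<in> variable_words (Suc k) N"
      using substitute_word_variable[OF len ws(3) v'] ws(2) by simp
    ultimately show "\<exists>w \<in> variable_words (Suc k) N. monochromatic c (line (Suc k) w)" by blast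
  qed
qed

text \<open>
  Larger dimensions follow by fixing the additional coordinates to the letter 1.
\<close>

theorem Hales_Jewett:
  fixes C :: "nat set"
  assumes "finite C" "k \<ge> 1"
  shows "\<exists>N>0. \<forall>n\<ge>N. \<forall>c \<in> cube k n \<rightarrow> C.
    \<exists>w \<in> variable_words k n. monochromatic c (line k w)"
proof -
  obtain N where
    N: "\<forall>c \<in> cube k N \<rightarrow> C. \<exists>w \<in> variable_words k N. monochromatic c (line k w)"
    using Hales_Jewett_dimension[OF assms] by blast
  show ?thesis
  proof (intro exI[of _ "Suc N"] conjI allI impI ballI)
    fix n c assume "Suc N \<le> n" and c: "c \<in> cube k n \<rightarrow> C"
    then obtain m where n: "n = N + m" using le_Suc_ex Suc_leD by blast
    have pad: "replicate m 1 \<in> cube k m" using assms(2) by (auto simp: cube_def)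
    have "(\<lambda>p. c (p @ replicate m 1)) \<in> cube k N \<rightarrow> C"
      using append_in_cube[OF _ pad] c n by blast
    with N obtain w where w: "w \<in> variable_words k N"
      "monochromatic (\<lambda>p. c (p @ replicate m 1)) (line k w)" by blast
    have "w @ replicate m (Some 1) \<in> variable_words k n"
      using w(1) assms(2) n by (auto simp: variable_words_def)
    moreover have "monochromatic c (line k (w @ replicate m (Some 1)))"
      using w(2) by (simp add: monochromatic_def line_def word_at_def)
    ultimately show "\<exists>w \<in> variable_words k n. monochromatic c (line k w)" by blast
  qed simp
qed

section \<open>A colouring of the cube of dimension 13\<close>

text \<open>
  The squares \<open>(a - 1)\<^sup>2\<close> are the weights 0, 1, 4 of the letters 1, 2, 3. With the simpler weights
  0, 1, 2 lines would give arithmetic progressions \<open>s\<close>, \<open>s + r\<close>, \<open>s + 2 r\<close>, and the van der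
  Waerden number \<open>W(3;3) = 27\<close> rules out such a colouring in dimension 13, where the weights
  take all 27 values from 0 to 26.
\<close>

definition weight :: "nat list \<Rightarrow> nat" where
  "weight p = (\<Sum>a\<leftarrow>p. (a - 1)\<^sup>2)"

lemma weight_word_at:
  "weight (word_at w a) =
     weight (word_at w 1) + length (filter (\<lambda>s. s = None) w) * (a - 1)\<^sup>2"
  by (induction w) (auto simp: weight_def word_at_def split: option.splits)

text \<open>
  The cubic residue character modulo 13: since \<open>4 = (13 - 1) / 3\<close>, the fourth power maps the
  three cosets of the nonzero cubes to the three cube roots of unity 1, 3, 9, and multiples of 13
  to 0.
\<close>

definition cubic_class :: "nat \<Rightarrow> nat" where
  "cubic_class x = x ^ 4 mod 13"

lemma cubic_class_cong: "[x = y] (mod 13) \<Longrightarrow> cubic_class x = cubic_class y"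
  using cong_pow[of x y 13 4] by (simp add: cubic_class_def cong_def)

lemma cubic_class_mult: "cubic_class (x * y) = cubic_class x * cubic_class y mod 13"
  by (simp add: cubic_class_def power_mult_distrib mod_mult_eq)

lemma cubic_class_mod: "cubic_class (x mod 13 + y) = cubic_class (x + y)"
  by (intro cubic_class_cong) (simp add: cong_def mod_add_left_eq)

lemma less_13_iff: "u < 13 \<longleftrightarrow> u \<in> {0, 1, 2, 3, 4, 5, 6, 7, 8, 9, 10, 11, 12 :: nat}"
  by (simp only: insert_iff empty_iff) presburger

lemma cubic_class_values: "cubic_class x \<in> {0, 1, 3, 9}"
proof -
  have "x mod 13 \<in> {0, 1, 2, 3, 4, 5, 6, 7, 8, 9, 10, 11, 12}"
    unfolding less_13_iff[symmetric] by simp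
  then have "cubic_class (x mod 13) \<in> {0, 1, 3, 9}"
    by (elim insertE emptyE) (simp_all add: cubic_class_def)
  then show ?thesis using cubic_class_mod[of x 0] by simp
qed

lemma cubic_class_separates_unit_step:
  "\<exists>i\<in>{0, 1, 4}. \<exists>j\<in>{0, 1, 4}. cubic_class (u + i) \<noteq> 0 \<and> cubic_class (u + j) \<noteq> 0 \<and>
     cubic_class (u + i) \<noteq> cubic_class (u + j)"
proof -
  have "\<exists>i\<in>{0, 1, 4}. \<exists>j\<in>{0, 1, 4}. cubic_class (v + i) \<noteq> 0 \<and>
      cubic_class (v + j) \<noteq> 0 \<and> cubic_class (v + i) \<noteq> cubic_class (v + j)"
    if "v \<in> {0, 1, 2, 3, 4, 5, 6, 7, 8, 9, 10, 11, 12}" for v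
    using that by (elim insertE emptyE) (simp_all add: cubic_class_def del: One_nat_def)
  from this[of "u mod 13"] show ?thesis
    unfolding less_13_iff[symmetric] cubic_class_mod by simp
qed

text \<open>
  Multiplication by an inverse \<open>t\<close> of \<open>r\<close> modulo 13 reduces the claim to the case \<open>r = 1\<close>, since
  the character is multiplicative.
\<close>

lemma cubic_class_separates:
  assumes "\<not> 13 dvd r"
  shows "\<exists>i\<in>{0, 1, 4}. \<exists>j\<in>{0, 1, 4}. cubic_class (s + r * i) \<noteq> 0 \<and>
    cubic_class (s + r * j) \<noteq> 0 \<and> cubic_class (s + r * i) \<noteq> cubic_class (s + r * j)"
proof -
  have "prime (13 :: nat)" by simp
  from prime_imp_coprime[OF this assms] have "coprime r 13" by (simp add: coprime_commute)
  then obtain t where t: "[r * t = 1] (mod 13)"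
    using cong_solve_coprime_nat[of r 13] by auto
  have "cubic_class (t * s + i) = cubic_class t * cubic_class (s + r * i) mod 13" for i
  proof -
    have "[i = r * t * i] (mod 13)" using cong_sym[OF cong_scalar_right[OF t, of i]] by simp
    then have "[t * s + i = t * s + r * t * i] (mod 13)" by (intro cong_add cong_refl)
    also have "t * s + r * t * i = t * (s + r * i)" by (simp add: algebra_simps)
    finally have "[t * s + i = t * (s + r * i)] (mod 13)" .
    from cubic_class_cong[OF this] show ?thesis by (simp only: cubic_class_mult)
  qed
  note scale = this
  obtain i j where ij: "i \<in> {0, 1, 4}" "j \<in> {0, 1, 4}" "cubic_class (t * s + i) \<noteq> 0"
      "cubic_class (t * s + j) \<noteq> 0" "cubic_class (t * s + i) \<noteq> cubic_class (t * s + j)"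
    using cubic_class_separates_unit_step by blast
  have "cubic_class (s + r * i) \<noteq> 0" using ij(3) unfolding scale by (rule contrapos_nn) simp
  moreover have "cubic_class (s + r * j) \<noteq> 0"
    using ij(4) unfolding scale by (rule contrapos_nn) simp
  moreover have "cubic_class (s + r * i) \<noteq> cubic_class (s + r * j)"
    using ij(5) unfolding scale by (rule contrapos_nn) simp
  ultimately show ?thesis using ij(1,2) by blast
qed

text \<open>
  Where the weight vanishes modulo 13 the colour matters on the diagonal only; looking at the
  first letter distinguishes \<open>1 \<dots> 1\<close> from \<open>2 \<dots> 2\<close> there.
\<close>

definition colouring :: "nat list \<Rightarrow> nat" where
  "colouring p =
     (let x = cubic_class (weight p) in
      if x = 0 then (if hd p = 1 then 1 else 2)
      else if x = 1 then 1 else if x = 3 then 2 else 3)"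

lemma colouring_eq_imp:
  assumes "colouring p = colouring q"
    and "cubic_class (weight p) \<noteq> 0" "cubic_class (weight q) \<noteq> 0"
  shows "cubic_class (weight p) = cubic_class (weight q)"
  using assms cubic_class_values[of "weight p"] cubic_class_values[of "weight q"]
  by (auto simp: colouring_def split: if_splits)

text \<open>
  The number of active coordinates of a line lies between 1 and 13, so it is prime to 13 unless
  the line is the diagonal.
\<close>

lemma colouring_line_free:
  assumes w: "w \<in> variable_words 3 13"
  shows "\<not> monochromatic colouring (line 3 w)"
proof
  assume "monochromatic colouring (line 3 w)"
  then have mono: "colouring (word_at w a) = colouring (word_at w b)"
    if "a \<in> {1..3}" "b \<in> {1..3}" for a b
    using that unfolding monochromatic_def line_def by (metis imageI)
  let ?r = "length (filter (\<lambda>s. s = None) w)"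
  have len: "length w = 13" and "None \<in> set w" using w by (auto simp: variable_words_def)
  then have pos: "?r > 0" by (auto simp: filter_empty_conv)
  show False
  proof (cases "?r = 13")
    case True
    have "s = None" if "s \<in> set w" for s
      using length_filter_less[OF that, of "\<lambda>s. s = None"] True len by fastforce
    then have "w = replicate 13 None" using replicate_length_same[of w None] len by auto
    then have wa: "word_at w a = replicate 13 a" for a by (simp add: word_at_def)
    have "cubic_class (weight (replicate 13 a)) = 0" for a
      by (simp add: weight_def cubic_class_def sum_list_replicate power_mult_distrib)
    then have "colouring (replicate 13 1) = 1" "colouring (replicate 13 2) = 2"
      by (simp_all add: colouring_def)
    with mono[of 1 2] show False by (simp add: wa)
  next
    case False
    then have "\<not> 13 dvd ?r"
      using pos length_filter_le[of "\<lambda>s. s = None" w] len by (auto dest: dvd_imp_le)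
    from cubic_class_separates[OF this, of "weight (word_at w 1)"]
    obtain i j where ij: "i \<in> {0, 1, 4}" "j \<in> {0, 1, 4}"
      "cubic_class (weight (word_at w 1) + ?r * i) \<noteq> 0"
      "cubic_class (weight (word_at w 1) + ?r * j) \<noteq> 0"
      "cubic_class (weight (word_at w 1) + ?r * i) \<noteq>
       cubic_class (weight (word_at w 1) + ?r * j)" by blast
    have letter: "\<exists>a\<in>{1..3}. i = (a - 1)\<^sup>2" if "i \<in> {0, 1, 4}" for i :: nat
    proof -
      have "\<exists>a\<in>{1, 2, 3}. i = (a - 1)\<^sup>2" using that by simp
      moreover have "{1, 2, 3} \<subseteq> {1..3::nat}" by simp
      ultimately show ?thesis by blast
    qed
    obtain a b where ab: "a \<in> {1..3}" "i = (a - 1)\<^sup>2" "b \<in> {1..3}" "j = (b - 1)\<^sup>2"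
      using letter ij(1,2) by meson
    show False
      using colouring_eq_imp[OF mono[OF ab(1,3)]] ij(3-5)
      unfolding ab(2,4) weight_word_at[of w a] weight_word_at[of w b] by blast
  qed
qed

theorem theorem8: "HJ 3 3 \<ge> 14"
proof (rule ccontr)
  assume "\<not> HJ 3 3 \<ge> 14"
  then have "HJ 3 3 \<le> 13" by simp
  let ?P = "\<lambda>N. N > 0 \<and> (\<forall>n\<ge>N. \<forall>c \<in> cube 3 n \<rightarrow> {1..3::nat}.
        \<exists>w \<in> variable_words 3 n. monochromatic c (line 3 w))"
  have "\<exists>N. ?P N" using Hales_Jewett[of "{1..3}" 3] by simp
  then have "?P (HJ 3 3)" unfolding HJ_def by (rule LeastI_ex)
  moreover have "colouring \<in> cube 3 13 \<rightarrow> {1..3}" by (simp add: colouring_def Let_def)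
  ultimately obtain w where "w \<in> variable_words 3 13" "monochromatic colouring (line 3 w)"
    using \<open>HJ 3 3 \<le> 13\<close> by blast
  then show False using colouring_line_free by blast
qed

end
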